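(* Let $n$ be a power of two. Then the graph $\mathcal{B}_n$ contains an independent set of size at least $n!/4^n$.
   Context: $S_n$ is the symmetric group on $[n]=\{1,\ldots,n\}$. A permutation $\tau\in S_n$ is called a cycle if, except for its fixed points, it consists of a single non-trivial cycle (of any length between $2$ and $n$; in particular the identity is not a cycle). Let $\mathcal{C}_n\subset S_n$ be the set of cycles. The (Birkhoff polytope) graph $\mathcal{B}_n=\mathrm{Cay}(S_n,\mathcal{C}_n)$ is the undirected graph with vertex set $S_n$ and edges $\{\pi,\tau\pi\}$ for $\pi\in S_n$, $\tau\in\mathcal{C}_n$. An independent set is a set $A\subset S_n$ containing no two adjacent vertices, i.e. there are no $\pi,\pi'\in A$ with $\pi(\pi')^{-1}\in\mathcal{C}_n$. *)

theory Defs
  imports Complex_Main "HOL-Combinatorics.Cycles" "HOL-Library.Ramsey"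
begin

definition birkhoff_verts :: "nat \<Rightarrow> (nat \<Rightarrow> nat) set" where
  "birkhoff_verts n = {p. p permutes {1..n}}"

text \<open>
  Since \<^const>\<open>cycle_of_list\<close> sends lists of length at most one to the identity, the length
  condition is what makes the cycle non-trivial.
\<close>

definition perm_cycles :: "nat \<Rightarrow> (nat \<Rightarrow> nat) set" where
  "perm_cycles n =
     {\<tau>. \<exists>cs. cycle cs \<and> length cs \<ge> 2 \<and> set cs \<subseteq> {1..n} \<and> \<tau> = cycle_of_list cs}"

definition birkhoff_edges :: "nat \<Rightarrow> (nat \<Rightarrow> nat) set set" where
  "birkhoff_edges n = {{\<pi>, \<tau> \<circ> \<pi>} | \<pi> \<tau>. \<pi> \<in> birkhoff_verts n \<and> \<tau> \<in> perm_cycles n}"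

lemma perm_cycles_subset: "perm_cycles n \<subseteq> birkhoff_verts n"
  by (auto simp: perm_cycles_def birkhoff_verts_def intro: permutes_subset[OF cycle_permutes])

lemma id_notin_perm_cycles: "id \<notin> perm_cycles n"
proof
  assume "id \<in> perm_cycles n"
  then obtain cs :: "nat list" where cs: "cycle cs" "length cs \<ge> 2" "id = cycle_of_list cs"
    by (auto simp: perm_cycles_def)
  obtain i j ds where ds: "cs = i # j # ds"
    using cs(2) by (cases cs; cases "tl cs") auto
  have "rotate 1 cs = cs"
    using cyclic_rotation[OF cs(1), of 1] by (simp flip: cs(3))
  then have "hd (rotate1 cs) = hd cs"
    by simp
  moreover have "hd (rotate1 cs) = j" "hd cs = i"
    by (simp_all add: ds)
  moreover have "i \<noteq> j"
    using cs(1) by (simp add: ds)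
  ultimately show False
    by metis
qed

lemma inv_perm_cycles:
  assumes "\<tau> \<in> perm_cycles n"
  shows "inv \<tau> \<in> perm_cycles n"
proof -
  obtain cs :: "nat list" where cs: "cycle cs" "length cs \<ge> 2" "set cs \<subseteq> {1..n}"
      "\<tau> = cycle_of_list cs"
    using assms by (auto simp: perm_cycles_def)
  have bij: "bij \<tau>"
    using cs(4) cycle_permutes permutes_bij by blast
  have c: "cycle (rev cs)"
    using cs(1) by simp
  have "cycle_of_list (rev cs) (\<tau> x) = x" for x
  proof (cases "x \<in> set cs")
    case False
    then show ?thesis
      using cs(4) by (simp add: id_outside_supp)
  next
    case True
    have "map \<tau> cs = rotate1 cs"
      using cyclic_rotation[OF cs(1), of 1] cs(4) by simp
    then have "map (cycle_of_list (rev cs) \<circ> \<tau>) cs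
        = map (cycle_of_list (rev cs)) (rotate1 cs)"
      by (metis map_map)
    also have "\<dots> = rotate1 (rev (map (cycle_of_list (rev cs)) (rev cs)))"
      by (simp add: rotate1_map rev_map)
    also have "\<dots> = rotate1 (rev (rotate1 (rev cs)))"
      using cyclic_rotation[OF c, of 1] by simp
    also have "\<dots> = cs"
      by (cases cs rule: rev_cases) simp_all
    finally have "map (cycle_of_list (rev cs) \<circ> \<tau>) cs = map id cs"
      by simp
    then show ?thesis
      using True unfolding map_eq_conv by auto
  qed
  then have "cycle_of_list (rev cs) \<circ> \<tau> = id"
    by auto
  then have "(cycle_of_list (rev cs) \<circ> \<tau>) \<circ> inv \<tau> = inv \<tau>"
    by simp
  then have "inv \<tau> = cycle_of_list (rev cs)"
    using bij by (simp add: comp_assoc bij_is_surj surj_iff[THEN iffD1])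
  then show ?thesis
    using cs(2,3) c unfolding perm_cycles_def by (intro CollectI exI[of _ "rev cs"]) simp
qed

lemma indep_birkhoff_iff:
  assumes A: "A \<subseteq> birkhoff_verts n"
  shows "indep A (birkhoff_edges n) \<longleftrightarrow> \<not> (\<exists>\<pi>\<in>A. \<exists>\<pi>'\<in>A. \<pi> \<circ> inv \<pi>' \<in> perm_cycles n)"
proof -
  have bij: "bij \<pi>" if "\<pi> \<in> birkhoff_verts n" for \<pi>
    using that by (auto simp: birkhoff_verts_def dest: permutes_bij)
  have cancel: "(\<tau> \<circ> \<pi>) \<circ> inv \<pi> = \<tau>" if "bij \<pi>" for \<tau> \<pi> :: "nat \<Rightarrow> nat"
    using that by (simp add: comp_assoc bij_is_surj surj_iff[THEN iffD1])
  have inv_quot: "inv (\<sigma> \<circ> inv \<pi>) = \<pi> \<circ> inv \<sigma>" if "bij \<pi>" "bij \<sigma>"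
    for \<pi> \<sigma> :: "nat \<Rightarrow> nat"
    using that by (simp add: o_inv_distrib bij_imp_bij_inv inv_inv_eq)
  have adj: "\<pi> \<noteq> \<sigma> \<and> {\<pi>, \<sigma>} \<in> birkhoff_edges n \<longleftrightarrow> \<pi> \<circ> inv \<sigma> \<in> perm_cycles n"
    if "\<pi> \<in> A" "\<sigma> \<in> A" for \<pi> \<sigma>
  proof
    have b: "bij \<pi>" "bij \<sigma>"
      using that A bij by auto
    { assume "\<pi> \<noteq> \<sigma> \<and> {\<pi>, \<sigma>} \<in> birkhoff_edges n"
      then obtain \<tau> where \<tau>: "\<tau> \<in> perm_cycles n" "\<sigma> = \<tau> \<circ> \<pi> \<or> \<pi> = \<tau> \<circ> \<sigma>"
        unfolding birkhoff_edges_def by (auto simp: doubleton_eq_iff)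
      from \<tau>(2) show "\<pi> \<circ> inv \<sigma> \<in> perm_cycles n"
      proof
        assume "\<sigma> = \<tau> \<circ> \<pi>"
        then have "inv (\<sigma> \<circ> inv \<pi>) \<in> perm_cycles n"
          using \<tau>(1) cancel[OF b(1)] inv_perm_cycles by simp
        then show ?thesis
          using inv_quot[OF b] by simp
      next
        assume "\<pi> = \<tau> \<circ> \<sigma>"
        then show ?thesis
          using \<tau>(1) cancel[OF b(2)] by simp
      qed }
    { assume q: "\<pi> \<circ> inv \<sigma> \<in> perm_cycles n"
      have "\<pi> \<noteq> \<sigma>"
        using q b id_notin_perm_cycles by (auto simp: bij_is_surj surj_iff[THEN iffD1])
      moreover have "\<pi> = (\<pi> \<circ> inv \<sigma>) \<circ> \<sigma>"
        using b(2) by (simp add: comp_assoc bij_is_inj)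
      then have "{\<pi>, \<sigma>} = {\<sigma>, (\<pi> \<circ> inv \<sigma>) \<circ> \<sigma>}"
        by auto
      ultimately show "\<pi> \<noteq> \<sigma> \<and> {\<pi>, \<sigma>} \<in> birkhoff_edges n"
        using q that A unfolding birkhoff_edges_def by blast }
  qed
  show ?thesis
    unfolding indep_def using adj by blast
qed

end

(*
  It suffices to colour the bijections from X to Y properly with 4^n colours, n = |X| = |Y|, and
  to take a largest colour class.  Halve X into L and R, and let the colour of p record the set
  T = p ` L (at most 2^n choices) together with the sum, modulo the number of colours for n/2, of
  the recursive colours of p : L -> T and p : R -> Y - T.  If p and tau p have the same T, then
  the cycle tau preserves T, so its support lies in T or misses T; hence exactly one of the two
  summands changes.  As 2^n * 4^(n/2) = 4^n, the recursion closes.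
*)

theory Submission
  imports Defs "HOL-Number_Theory.Cong"
begin

text \<open>The first clause makes the colour depend only on the restriction of \<open>p\<close> to
  \<open>X\<close>. It is needed because HOL functions are total, and the same \<open>p\<close> is
  passed to the colourings of both halves of its domain. The cycles act on the target side, as in
  the edges of the graph.\<close>

definition cycle_colouring ::
    "'a set \<Rightarrow> 'b set \<Rightarrow> nat \<Rightarrow> (('a \<Rightarrow> 'b) \<Rightarrow> nat) \<Rightarrow> bool" where
  "cycle_colouring X Y N c \<longleftrightarrow>
     (\<forall>p q. bij_betw p X Y \<and> (\<forall>x\<in>X. p x = q x) \<longrightarrow> c p = c q) \<and>
     (\<forall>p. bij_betw p X Y \<longrightarrow> c p < N) \<and>
     (\<forall>p cs. bij_betw p X Y \<and> cycle cs \<and> 2 \<le> length cs \<and> set cs \<subseteq> Y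
        \<longrightarrow> c (cycle_of_list cs \<circ> p) \<noteq> c p)"

lemma cycle_colouring_cong:
  "cycle_colouring X Y N c \<Longrightarrow> bij_betw p X Y \<Longrightarrow> (\<And>x. x \<in> X \<Longrightarrow> p x = q x) \<Longrightarrow> c p = c q"
  by (auto simp: cycle_colouring_def)

lemma cycle_colouring_less:
  "cycle_colouring X Y N c \<Longrightarrow> bij_betw p X Y \<Longrightarrow> c p < N"
  by (auto simp: cycle_colouring_def)

lemma cycle_colouring_proper:
  "cycle_colouring X Y N c \<Longrightarrow> bij_betw p X Y \<Longrightarrow> cycle cs \<Longrightarrow> 2 \<le> length cs
    \<Longrightarrow> set cs \<subseteq> Y \<Longrightarrow> c (cycle_of_list cs \<circ> p) \<noteq> c p"
  by (auto simp: cycle_colouring_def)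

text \<open>A cycle acts transitively on its support, so the orbit of a single support point in
  \<open>T\<close> sweeps out all of \<open>set cs\<close> without leaving \<open>T\<close>.\<close>

lemma support_subset_or_disjoint:
  assumes "cycle cs" and inv: "cycle_of_list cs ` T \<subseteq> T"
  shows "set cs \<subseteq> T \<or> set cs \<inter> T = {}"
proof (rule disjCI)
  assume "set cs \<inter> T \<noteq> {}"
  then obtain i where i: "i < length cs" "cs ! i \<in> T"
    by (auto simp: in_set_conv_nth)
  have orbit: "(cycle_of_list cs ^^ k) (cs ! i) \<in> T" for k
    by (induction k) (use i inv in auto)
  have "cs ! j \<in> T" if j: "j < length cs" for j
  proof -
    \<comment> \<open>This is j - i modulo the length, shifted so that the subtraction on naturals
      does not truncate: k + i = j + \<open>length cs\<close>.\<close>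
    define k where "k = j + (length cs - i)"
    have "(cycle_of_list cs ^^ k) (cs ! i) = rotate k cs ! i"
      using cyclic_rotation[OF \<open>cycle cs\<close>, of k] i by (metis nth_map)
    also have "\<dots> = cs ! ((k + i) mod length cs)"
      using i by (simp add: nth_rotate)
    also have "(k + i) mod length cs = j"
      using i j by (simp add: k_def)
    finally show ?thesis
      using orbit[of k] by simp
  qed
  then show "set cs \<subseteq> T"
    by (auto simp: in_set_conv_nth)
qed

lemma bij_betw_cycle_of_list:
  assumes "set cs \<subseteq> Y"
  shows "bij_betw (cycle_of_list cs) Y Y"
  using permutes_imp_bij[OF permutes_subset[OF cycle_permutes assms]] .

text \<open>Here \<open>c\<close> and \<open>d\<close> are families because the image of
  \<open>L\<close> varies with the bijection. Recording the sum of the two colours modulo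
  \<open>N\<close>, and not the pair, costs a factor \<open>N\<close> instead of its square.\<close>

lemma cycle_colouring_Un:
  assumes disj: "L \<inter> R = {}" and "finite Y"
    and L: "\<And>T. T \<subseteq> Y \<Longrightarrow> card T = card L \<Longrightarrow> cycle_colouring L T N (c T)"
    and R: "\<And>T. T \<subseteq> Y \<Longrightarrow> card T = card L \<Longrightarrow> cycle_colouring R (Y - T) N (d T)"
  shows "\<exists>f. cycle_colouring (L \<union> R) Y (2 ^ card Y * N) f"
proof -
  obtain e where e: "bij_betw e (Pow Y) {0..<2 ^ card Y :: nat}"
    using ex_bij_betw_finite_nat[of "Pow Y"] \<open>finite Y\<close> by (auto simp: card_Pow)
  define f where "f p = e (p ` L) * N + (c (p ` L) p + d (p ` L) p) mod N" for p
  have split: "p ` L \<subseteq> Y \<and> card (p ` L) = card L \<and> bij_betw p L (p ` L) \<and>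
      bij_betw p R (Y - p ` L)" if p: "bij_betw p (L \<union> R) Y" for p
  proof -
    have inj: "inj_on p (L \<union> R)" and im: "p ` (L \<union> R) = Y"
      using p by (auto simp: bij_betw_def)
    have "p ` L \<inter> p ` R = {}"
      using inj_on_image_Int[OF inj, of L R] disj by simp
    then have "p ` R = Y - p ` L"
      using im by (auto simp: image_Un)
    then show ?thesis
      using inj im by (auto simp: bij_betw_def inj_on_Un card_image)
  qed
  have "f p = f q" if p: "bij_betw p (L \<union> R) Y" and eq: "\<forall>x\<in>L \<union> R. p x = q x" for p q
  proof -
    have "p ` L = q ` L"
      using eq by (intro image_cong) auto
    moreover have "c (p ` L) p = c (p ` L) q" "d (p ` L) p = d (p ` L) q"
      using split[OF p] eq
      by (auto intro: cycle_colouring_cong[OF L] cycle_colouring_cong[OF R])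
    ultimately show ?thesis
      by (simp add: f_def)
  qed
  moreover have "f p < 2 ^ card Y * N" if p: "bij_betw p (L \<union> R) Y" for p
  proof -
    \<comment> \<open>The bijection \<open>p\<close> itself has a colour below
      \<open>N\<close>.\<close>
    have "N > 0"
      using split[OF p] cycle_colouring_less[OF L, of "p ` L" p] by simp
    then have "f p < Suc (e (p ` L)) * N"
      by (simp add: f_def)
    also have "Suc (e (p ` L)) \<le> 2 ^ card Y"
      using split[OF p] bij_betwE[OF e] by (simp add: Suc_le_eq)
    finally show ?thesis
      by simp
  qed
  moreover have "f (cycle_of_list cs \<circ> p) \<noteq> f p"
    if p: "bij_betw p (L \<union> R) Y" and cs: "cycle cs" "2 \<le> length cs" "set cs \<subseteq> Y" for p cs
  proof
    define T where "T = p ` L"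
    define q where "q = cycle_of_list cs \<circ> p"
    assume "f (cycle_of_list cs \<circ> p) = f p"
    then have eq: "f q = f p"
      by (simp add: q_def)
    have q: "bij_betw q (L \<union> R) Y"
      unfolding q_def using bij_betw_trans[OF p bij_betw_cycle_of_list[OF cs(3)]] .
    note T = split[OF p, folded T_def]
    have "N > 0"
      using T cycle_colouring_less[OF L, of T p] by simp
    have "e (q ` L) = f q div N" "e T = f p div N"
      using \<open>N > 0\<close> by (simp_all add: f_def T_def)
    then have "e (q ` L) = e T"
      using eq by simp
    \<comment> \<open>Equal quotients give equal images, since \<open>e\<close> is injective on the
      subsets of \<open>Y\<close>.\<close>
    then have qL: "q ` L = T"
      using split[OF q] T bij_betw_imp_inj_on[OF e] by (auto dest: inj_onD)
    have "(c T q + d T q) mod N = f q mod N" "(c T p + d T p) mod N = f p mod N"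
      by (simp_all add: f_def T_def qL[unfolded T_def])
    then have sum_eq: "[c T q + d T q = c T p + d T p] (mod N)"
      using eq by (simp add: cong_def)
    have less: "c T q < N" "c T p < N" "d T q < N" "d T p < N"
      using T split[OF q] qL by (auto intro: cycle_colouring_less[OF L] cycle_colouring_less[OF R])
    have "cycle_of_list cs ` T \<subseteq> T"
      using qL by (simp add: q_def T_def image_comp)
    from support_subset_or_disjoint[OF cs(1) this] show False
    proof
      assume sub: "set cs \<subseteq> T"
      \<comment> \<open>On \<open>R\<close> the values of \<open>p\<close> lie outside
        \<open>T\<close>, where the cycle fixes everything. So the second summand is unchanged and
        cancels; the first colours are then congruent and below \<open>N\<close>, hence equal,
        against properness on \<open>T\<close>.\<close>
      have "p x = q x" if "x \<in> R" for x
        using that T sub by (auto simp: q_def bij_betw_def intro!: id_outside_supp[symmetric])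
      then have "d T p = d T q"
        using T by (intro cycle_colouring_cong[OF R]) auto
      then have "c T q = c T p"
        using sum_eq less by (simp add: cong_add_rcancel_nat cong_less_modulus_unique_nat)
      moreover have "c T q \<noteq> c T p"
        unfolding q_def using T cs sub by (intro cycle_colouring_proper[OF L]) auto
      ultimately show False
        by simp
    next
      assume dis: "set cs \<inter> T = {}"
      \<comment> \<open>Now the cycle fixes \<open>T\<close> pointwise and moves only points of
        \<open>Y - T\<close>, so \<open>c\<close> and \<open>d\<close> exchange roles.\<close>
      have "p x = q x" if "x \<in> L" for x
        using that dis by (auto simp: q_def T_def intro!: id_outside_supp[symmetric])
      then have "c T p = c T q"
        using T by (intro cycle_colouring_cong[OF L]) auto
      then have "d T q = d T p"
        using sum_eq less by (simp add: cong_add_lcancel_nat cong_less_modulus_unique_nat)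
      moreover have "d T q \<noteq> d T p"
        unfolding q_def using T cs dis by (intro cycle_colouring_proper[OF R]) auto
      ultimately show False
        by simp
    qed
  qed
  ultimately have "cycle_colouring (L \<union> R) Y (2 ^ card Y * N) f"
    by (simp add: cycle_colouring_def)
  then show ?thesis
    by blast
qed

text \<open>The halves are mapped onto varying sets \<open>T\<close> and \<open>Y - T\<close>, so
  the induction has to allow arbitrary targets \<open>Y\<close>. A power of two can be halved evenly
  down to a single point.\<close>

lemma ex_cycle_colouring:
  assumes "finite X" "finite Y" "card X = 2 ^ k" "card Y = 2 ^ k"
  shows "\<exists>c. cycle_colouring X Y (4 ^ 2 ^ k) c"
  using assms
proof (induction k arbitrary: X Y)
  case 0
  \<comment> \<open>A one-point target has no room for a non-trivial cycle, so properness is vacuous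
    and a constant colouring will do.\<close>
  have "card (set cs) \<le> 1" if "set cs \<subseteq> Y" for cs
    using card_mono[OF \<open>finite Y\<close> that] 0 by simp
  then have "\<not> (cycle cs \<and> 2 \<le> length cs \<and> set cs \<subseteq> Y)" for cs
    by (auto dest!: distinct_card) (metis One_nat_def not_less_eq_eq numeral_2_eq_2)
  then have "cycle_colouring X Y (4 ^ 2 ^ 0) (\<lambda>_. 0)"
    by (auto simp: cycle_colouring_def)
  then show ?case
    by blast
next
  case (Suc k)
  obtain L where L: "L \<subseteq> X" "card L = 2 ^ k" "finite L"
    using obtain_subset_with_card_n[of "2 ^ k" X] Suc.prems by auto
  have R: "finite (X - L)" "card (X - L) = 2 ^ k"
    using L Suc.prems by (auto simp: card_Diff_subset)
  have T: "finite T \<and> finite (Y - T) \<and> card T = 2 ^ k \<and> card (Y - T) = 2 ^ k"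
    if "T \<subseteq> Y" "card T = card L" for T
    using that L Suc.prems finite_subset[OF that(1)] by (auto simp: card_Diff_subset)
  have "\<exists>c. cycle_colouring L T (4 ^ 2 ^ k) c" if "T \<subseteq> Y" "card T = card L" for T
    using T[OF that] L by (intro Suc.IH) auto
  then obtain c
    where c: "\<And>T. T \<subseteq> Y \<Longrightarrow> card T = card L \<Longrightarrow> cycle_colouring L T (4 ^ 2 ^ k) (c T)"
    by metis
  have "\<exists>d. cycle_colouring (X - L) (Y - T) (4 ^ 2 ^ k) d"
    if "T \<subseteq> Y" "card T = card L" for T
    using T[OF that] R by (intro Suc.IH) auto
  then obtain d where d: "\<And>T. T \<subseteq> Y \<Longrightarrow> card T = card L
      \<Longrightarrow> cycle_colouring (X - L) (Y - T) (4 ^ 2 ^ k) (d T)"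
    by metis
  have "\<exists>f. cycle_colouring (L \<union> (X - L)) Y (2 ^ card Y * 4 ^ 2 ^ k) f"
    using c d Suc.prems(2) by (intro cycle_colouring_Un) auto
  moreover have "(2::nat) ^ card Y * 4 ^ 2 ^ k = 4 ^ 2 ^ Suc k"
  proof -
    have "(2::nat) ^ card Y = 4 ^ 2 ^ k"
      using Suc.prems(4) power_mult[of "2::nat" 2 "2 ^ k"] by simp
    then show ?thesis
      by (simp add: mult_2 flip: power_add)
  qed
  moreover have "L \<union> (X - L) = X"
    using L by blast
  ultimately show ?case
    by simp
qed

text \<open>Pigeonhole by averaging: the fibres over the \<open>N\<close> colours partition
  \<open>V\<close>, so they cannot all be smaller than their mean.\<close>

lemma ex_large_fibre:
  fixes c :: "'a \<Rightarrow> nat"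
  assumes "finite V" "c ` V \<subseteq> {..<N}" "N > 0"
  shows "\<exists>i. real (card V) / real N \<le> real (card {v \<in> V. c v = i})"
proof (rule ccontr)
  assume "\<not> ?thesis"
  then have "(\<Sum>i<N. real (card {v \<in> V. c v = i})) < (\<Sum>i<N. real (card V) / real N)"
    using \<open>N > 0\<close> by (intro sum_strict_mono) (auto simp: not_le)
  moreover have "(\<Sum>i<N. card {v \<in> V. c v = i}) = card V"
    using sum.group[OF \<open>finite V\<close> _ assms(2), of "\<lambda>_. 1::nat"] by simp
  ultimately show False
    using \<open>N > 0\<close> by (simp flip: of_nat_sum)
qed

theorem theorem1p7:
  fixes n :: nat
  assumes "\<exists>k::nat. n = 2 ^ k"
  shows "\<exists>A. A \<subseteq> birkhoff_verts n \<and> indep A (birkhoff_edges n)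
           \<and> real (card A) \<ge> fact n / 4 ^ n"
proof -
  obtain c where c: "cycle_colouring {1..n} {1..n} (4 ^ n) c"
    using ex_cycle_colouring[of "{1..n}" "{1..n}"] assms by auto
  have bij: "bij_betw p {1..n} {1..n}" if "p \<in> birkhoff_verts n" for p
    using that by (auto simp: birkhoff_verts_def permutes_imp_bij)
  have fin: "finite (birkhoff_verts n)" and card: "card (birkhoff_verts n) = fact n"
    by (simp_all add: birkhoff_verts_def finite_permutations card_permutations)
  have "c ` birkhoff_verts n \<subseteq> {..<4 ^ n}"
    using cycle_colouring_less[OF c] bij by auto
  from ex_large_fibre[OF fin this] obtain i
    where i: "fact n / 4 ^ n \<le> real (card {p \<in> birkhoff_verts n. c p = i})"
    by (auto simp: card)
  define A where "A = {p \<in> birkhoff_verts n. c p = i}"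
  \<comment> \<open>This is independence in the form of \<open>indep_birkhoff_iff\<close>: were the
    quotient a cycle, \<open>p\<close> would arise from \<open>q\<close> by composing with it on the
    left, and the two colours would differ.\<close>
  have "p \<circ> inv q \<notin> perm_cycles n" if "p \<in> A" "q \<in> A" for p q
  proof
    assume "p \<circ> inv q \<in> perm_cycles n"
    then obtain cs where cs: "cycle cs" "2 \<le> length cs" "set cs \<subseteq> {1..n}"
        "p \<circ> inv q = cycle_of_list cs"
      by (auto simp: perm_cycles_def)
    have "inv q \<circ> q = id"
      using that(2) by (auto simp: A_def birkhoff_verts_def permutes_inv_o)
    then have "p = cycle_of_list cs \<circ> q"
      unfolding cs(4)[symmetric] by (simp add: comp_assoc)
    then have "c p \<noteq> c q"
      using cycle_colouring_proper[OF c bij cs(1-3)] that(2) by (auto simp: A_def)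
    then show False
      using that by (simp add: A_def)
  qed
  moreover have "A \<subseteq> birkhoff_verts n"
    by (auto simp: A_def)
  ultimately have "indep A (birkhoff_edges n)"
    by (auto simp: indep_birkhoff_iff)
  then show ?thesis
    using i[folded A_def] \<open>A \<subseteq> birkhoff_verts n\<close> by blast
qed

end
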